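(* Let $G$ be a finite simple undirected graph on $n$ vertices with $\kappa(G)$ connected components. Then $$\min\{s^+(G),s^-(G)\}\ge n-\kappa(G).$$
   Context: All graphs are finite, simple, and undirected. For a graph $G$ with $n$ vertices and adjacency matrix $A=A(G)$, let $\lambda_1,\ldots,\lambda_n$ be the (real) eigenvalues of $A$, counted with multiplicity. The positive square energy and the negative square energy of $G$ are $$s^+(G):=\sum_{\lambda_i>0}\lambda_i^2,\qquad s^-(G):=\sum_{\lambda_i<0}\lambda_i^2.$$ $\kappa(G)$ denotes the number of connected components of $G$ (isolated vertices count as components). *)

theory Defs
  imports "Graph_Theory.Digraph_Component" "Jordan_Normal_Form.Char_Poly"
begin

text \<open>
  A finite simple undirected graph is a \<^locale>\<open>pair_graph\<close>: a finite vertex set with a symmetric,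
  irreflexive set of arcs, each undirected edge being represented by its two orientations.
\<close>

text \<open>
  The list \<open>vs\<close> is meant to enumerate the vertices of \<open>G\<close> without repetition, which fixes the
  order of the rows and columns.
\<close>

definition adjacency_matrix :: "'a list \<Rightarrow> 'a pair_pre_digraph \<Rightarrow> real mat" where
  "adjacency_matrix vs G =
     mat (length vs) (length vs) (\<lambda>(i, j). if (vs ! i, vs ! j) \<in> parcs G then 1 else 0)"

text \<open>
  The real eigenvalues with algebraic multiplicity. For a real symmetric matrix these are all
  eigenvalues, and algebraic and geometric multiplicities agree.
\<close>

definition eigenvalues_mset :: "real mat \<Rightarrow> real multiset" where
  "eigenvalues_mset A = proots (char_poly A)"

lemma set_mset_eigenvalues_mset:
  assumes "A \<in> carrier_mat n n"
  shows "set_mset (eigenvalues_mset A) = {x. eigenvalue A x}"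
proof -
  have "char_poly A \<noteq> 0"
    using degree_monic_char_poly[OF assms] by auto
  then show ?thesis
    by (simp add: eigenvalues_mset_def eigenvalue_root_char_poly[OF assms])
qed

definition positive_square_energy :: "real mat \<Rightarrow> real" where
  "positive_square_energy A = (\<Sum>x\<in>#{#x \<in># eigenvalues_mset A. x > 0#}. x\<^sup>2)"

definition negative_square_energy :: "real mat \<Rightarrow> real" where
  "negative_square_energy A = (\<Sum>x\<in>#{#x \<in># eigenvalues_mset A. x < 0#}. x\<^sup>2)"

text \<open>
  Since the arcs of a \<^locale>\<open>pair_graph\<close> are symmetric, its strongly connected components are the
  connected components of the undirected graph; an isolated vertex is a component, because
  reachability is reflexive on the vertices.
\<close>

definition num_components :: "'a pair_pre_digraph \<Rightarrow> nat" where
  "num_components G = card (pre_digraph.sccs (with_proj G))"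

end

theory Submission
  imports Defs "Jordan_Normal_Form.Schur_Decomposition"
begin

text \<open>
  Write the adjacency matrix as \<open>A = P - N\<close>, where \<open>P\<close> and \<open>N\<close> are its positive and negative
  parts. Both are positive semidefinite, and their squared Frobenius norms are the two square
  energies. The lower bound on these norms is witnessed by a correlation matrix \<open>K\<close>: a positive
  semidefinite matrix, indexed by the vertices, with unit diagonal, such that
  \<open>K u v = - \<kappa>\<close> with \<open>\<kappa> = \<kappa>(u, v) \<ge> 0\<close> on every edge.

  The entrywise square of \<open>N\<close> is positive semidefinite by Schur's product theorem, hence
  \<open>\<Sum>u v. K u v * (N u v)^2 \<ge> 0\<close>. Off the edges \<open>N\<close> agrees with \<open>P\<close> and the entries of \<open>K\<close> are at
  most 1; on an edge \<open>N = P - 1\<close>. So the entries of \<open>P\<close> off the edges have total square at least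
  \<open>\<Sum> \<kappa> (1 - P u v)^2\<close>, summed over the arcs \<open>(u, v)\<close>. The squared norm of \<open>P\<close> is therefore at least
  \<open>\<Sum> (P u v)^2 + \<kappa> (1 - P u v)^2\<close>, and minimising every term over \<open>P u v\<close> leaves
  \<open>\<Sum> \<kappa> / (1 + \<kappa>)\<close>. The same argument with \<open>P\<close> and \<open>N\<close> exchanged bounds the norm of \<open>N\<close>
  (\<open>frobenius_ge_gain\<close>).

  It remains to find, for a connected graph on \<open>n\<close> vertices, a matrix \<open>K\<close> for which this sum, here
  called its gain, is at least \<open>n - 1\<close>. The two extreme cases are a tree, where \<open>K\<close> is the rank one
  matrix of the 2-colouring with \<open>\<kappa> = 1\<close>, and the complete graph, where \<open>K\<close> is the Gram matrix of a
  regular simplex with \<open>\<kappa> = 1 / (n - 1)\<close>. In general the proof is by induction on \<open>n\<close>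
  (\<open>linked_certifies\<close>). At a cut vertex, the vector configurations of the two sides can be rotated
  so that their vectors at the cut vertex coincide and are otherwise orthogonal; gains then add up
  (\<open>certifies_glue\<close>). If no vertex is a cut vertex, average the matrices of all the graphs obtained
  by deleting one vertex (\<open>certifies_from_vertex_deletions\<close>). Since every vertex is missing from
  one of them, the average is taken with weight \<open>1 / (n - 1)\<close>, and this slightly larger weight
  is what makes the gain grow by 1. For a disconnected graph the gains of the components add up.
\<close>

section \<open>Correlation matrices and their gain\<close>

definition quad_form :: "'a set \<Rightarrow> ('a \<Rightarrow> 'a \<Rightarrow> real) \<Rightarrow> ('a \<Rightarrow> real) \<Rightarrow> real" where
  "quad_form V K c = (\<Sum>u\<in>V. \<Sum>v\<in>V. c u * c v * K u v)"

definition correlation_on :: "'a set \<Rightarrow> ('a \<Rightarrow> 'a \<Rightarrow> real) \<Rightarrow> bool" where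
  "correlation_on V K \<longleftrightarrow>
     (\<forall>u\<in>V. \<forall>v\<in>V. K u v = K v u) \<and> (\<forall>v\<in>V. K v v = 1) \<and> (\<forall>c. 0 \<le> quad_form V K c)"

lemma correlation_onD:
  assumes "correlation_on V K"
  shows "u \<in> V \<Longrightarrow> v \<in> V \<Longrightarrow> K u v = K v u" "v \<in> V \<Longrightarrow> K v v = 1" "0 \<le> quad_form V K c"
  using assms by (auto simp: correlation_on_def)

lemma quad_form_add_at:
  assumes "finite V" "correlation_on V K" "x \<in> V"
  shows "quad_form V K (\<lambda>v. c v + (if v = x then t else 0))
       = quad_form V K c + 2 * t * (\<Sum>v\<in>V. c v * K v x) + t\<^sup>2"
proof -
  let ?d = "\<lambda>v. if v = x then t else 0 :: real"
  have pick: "(\<Sum>v\<in>V. ?d v * f v) = t * f x" for f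
    using assms(1,3) by (simp add: if_distrib[where f = "\<lambda>y. y * _"] cong: if_cong)
  have "quad_form V K (\<lambda>v. c v + ?d v)
      = quad_form V K c + (\<Sum>u\<in>V. c u * (\<Sum>v\<in>V. ?d v * K u v))
        + (\<Sum>u\<in>V. ?d u * (\<Sum>v\<in>V. c v * K u v)) + (\<Sum>u\<in>V. ?d u * (\<Sum>v\<in>V. ?d v * K u v))"
    unfolding quad_form_def sum_distrib_left sum.distrib[symmetric]
    by (intro sum.cong refl) (simp only: algebra_simps)
  also have "\<dots> = quad_form V K c + t * (\<Sum>u\<in>V. c u * K u x) + (t * (\<Sum>v\<in>V. c v * K x v) + t\<^sup>2 * K x x)"
    unfolding pick by (simp add: sum_distrib_left algebra_simps power2_eq_square)
  also have "(\<Sum>v\<in>V. c v * K x v) = (\<Sum>v\<in>V. c v * K v x)"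
    using correlation_onD(1)[OF assms(2)] assms(3) by (intro sum.cong) auto
  also have "K x x = 1" using correlation_onD(2)[OF assms(2,3)] .
  finally show ?thesis by (simp add: algebra_simps)
qed

text \<open>
  The left-hand side is the square of the component, along the unit vector at \<open>x\<close>, of the
  combination of vectors whose squared length is the right-hand side. Stated for the quadratic
  form, this needs no vectors: subtract that component and use that the form stays nonnegative.
\<close>

lemma quad_form_ge_square:
  assumes "finite V" "correlation_on V K" "x \<in> V"
  shows "(\<Sum>v\<in>V. c v * K v x)\<^sup>2 \<le> quad_form V K c"
proof -
  define b where "b = (\<Sum>v\<in>V. c v * K v x)"
  have "0 \<le> quad_form V K (\<lambda>v. c v + (if v = x then - b else 0))"
    by (rule correlation_onD(3)[OF assms(2)])
  also have "\<dots> = quad_form V K c - b\<^sup>2"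
    by (subst quad_form_add_at[OF assms]) (simp add: b_def[symmetric] power2_eq_square)
  finally show ?thesis by (simp add: b_def)
qed

lemma correlation_abs_le_1:
  assumes "finite V" "correlation_on V K" "u \<in> V" "v \<in> V"
  shows "\<bar>K u v\<bar> \<le> 1"
proof -
  let ?c = "\<lambda>w. if w = u then 1 else 0 :: real"
  have "(\<Sum>w\<in>V. ?c w * K w v) = K u v"
    using assms(1,3) by (simp add: if_distrib[where f = "\<lambda>y. y * _"] cong: if_cong)
  moreover have "quad_form V K ?c = K u u"
    using assms(1,3) unfolding quad_form_def
    by (simp add: if_distrib[where f = "\<lambda>y. y * _"] if_distrib[where f = "\<lambda>y. _ * y"] cong: if_cong)
  ultimately have "(K u v)\<^sup>2 \<le> 1"
    using quad_form_ge_square[OF assms(1,2,4), of ?c] correlation_onD(2)[OF assms(2,3)] by simp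
  then show ?thesis by (simp add: abs_square_le_1)
qed

text \<open>
  With \<open>\<kappa> = - K u v\<close>, each arc contributes \<open>\<kappa> / (1 + \<kappa>)\<close>, which for \<open>\<kappa> \<ge> 0\<close> is the minimum
  over real \<open>p\<close> of \<open>p^2 + \<kappa> (1 - p)^2\<close>. The sum runs over ordered pairs, so an undirected edge counts twice.
\<close>

definition gain :: "('a \<Rightarrow> 'a \<Rightarrow> bool) \<Rightarrow> 'a set \<Rightarrow> ('a \<Rightarrow> 'a \<Rightarrow> real) \<Rightarrow> real" where
  "gain E V K = (\<Sum>u\<in>V. \<Sum>v\<in>V. if E u v then - K u v / (1 - K u v) else 0)"

definition certifies :: "('a \<Rightarrow> 'a \<Rightarrow> bool) \<Rightarrow> 'a set \<Rightarrow> real \<Rightarrow> bool" where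
  "certifies E V r \<longleftrightarrow> (\<exists>K. correlation_on V K \<and> (\<forall>u\<in>V. \<forall>v\<in>V. E u v \<longrightarrow> K u v \<le> 0) \<and> r \<le> gain E V K)"

lemma certifiesI:
  assumes "correlation_on V K" "\<And>u v. u \<in> V \<Longrightarrow> v \<in> V \<Longrightarrow> E u v \<Longrightarrow> K u v \<le> 0" "r \<le> gain E V K"
  shows "certifies E V r"
  using assms by (auto simp: certifies_def)

lemma double_sum_Un:
  fixes f :: "'a \<Rightarrow> 'a \<Rightarrow> real"
  assumes "finite A" "finite B" "A \<inter> B = {}"
  shows "(\<Sum>u\<in>A \<union> B. \<Sum>v\<in>A \<union> B. f u v)
       = (\<Sum>u\<in>A. \<Sum>v\<in>A. f u v) + (\<Sum>u\<in>A. \<Sum>v\<in>B. f u v)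
         + (\<Sum>u\<in>B. \<Sum>v\<in>A. f u v) + (\<Sum>u\<in>B. \<Sum>v\<in>B. f u v)"
  using assms by (simp add: sum.union_disjoint sum.distrib)

section \<open>Building certificates\<close>

lemma certifies_disjoint_Un:
  assumes "finite V" "finite W" "V \<inter> W = {}" "certifies E V r" "certifies E W s"
  shows "certifies E (V \<union> W) (r + s)"
proof -
  obtain K where K: "correlation_on V K" "\<And>u v. u \<in> V \<Longrightarrow> v \<in> V \<Longrightarrow> E u v \<Longrightarrow> K u v \<le> 0" "r \<le> gain E V K"
    using assms(4) by (auto simp: certifies_def)
  obtain L where L: "correlation_on W L" "\<And>u v. u \<in> W \<Longrightarrow> v \<in> W \<Longrightarrow> E u v \<Longrightarrow> L u v \<le> 0" "s \<le> gain E W L"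
    using assms(5) by (auto simp: certifies_def)
  define M where "M u v = (if u \<in> V \<and> v \<in> V then K u v else if u \<in> W \<and> v \<in> W then L u v else 0)" for u v
  have MV: "M u v = K u v" if "u \<in> V" "v \<in> V" for u v using that by (simp add: M_def)
  have MW: "M u v = L u v" if "u \<in> W" "v \<in> W" for u v using that assms(3) by (auto simp: M_def)
  have MVW: "M u v = 0" "M v u = 0" if "u \<in> V" "v \<in> W" for u v using that assms(3) by (auto simp: M_def)
  show ?thesis
  proof (rule certifiesI)
    have "quad_form (V \<union> W) M c = quad_form V K c + quad_form W L c" for c
      unfolding quad_form_def double_sum_Un[OF assms(1-3)]
      by (simp add: MV MW MVW)
    then show "correlation_on (V \<union> W) M"
      using K(1) L(1) by (auto simp: correlation_on_def MV MW MVW)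
    have "gain E (V \<union> W) M = gain E V K + gain E W L"
      unfolding gain_def double_sum_Un[OF assms(1-3)]
      by (simp add: MV MW MVW cong: if_cong)
    then show "r + s \<le> gain E (V \<union> W) M" using K(3) L(3) by simp
  qed (auto simp: M_def K(2) L(2))
qed

text \<open>
  If \<open>K\<close> and \<open>L\<close> are Gram matrices of unit vectors, let the two vectors at \<open>x\<close> coincide and make the
  components orthogonal to it of the two families orthogonal to each other. The inner product of
  the vectors at \<open>u \<in> V\<close> and \<open>w \<in> W\<close> is then \<open>K u x * L x w\<close>, and the inner products within
  \<open>V\<close> and within \<open>W\<close> do not change. No edge joins the two sides outside \<open>x\<close>, so the gains add up.
\<close>

lemma certifies_glue:
  assumes "finite V" "finite W" "V \<inter> W = {x}"
    and E: "\<And>u w. u \<in> V - {x} \<Longrightarrow> w \<in> W - {x} \<Longrightarrow> \<not> E u w \<and> \<not> E w u" "\<not> E x x"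
    and "certifies E V r" "certifies E W s"
  shows "certifies E (V \<union> W) (r + s)"
proof -
  obtain K where K: "correlation_on V K" "\<And>u v. u \<in> V \<Longrightarrow> v \<in> V \<Longrightarrow> E u v \<Longrightarrow> K u v \<le> 0" "r \<le> gain E V K"
    using assms(6) by (auto simp: certifies_def)
  obtain L where L: "correlation_on W L" "\<And>u v. u \<in> W \<Longrightarrow> v \<in> W \<Longrightarrow> E u v \<Longrightarrow> L u v \<le> 0" "s \<le> gain E W L"
    using assms(7) by (auto simp: certifies_def)
  define W' where "W' = W - {x}"
  have x: "x \<in> V" "x \<in> W" using assms(3) by auto
  have W: "W = {x} \<union> W'" "{x} \<inter> W' = {}" and VW: "V \<union> W = V \<union> W'" "V \<inter> W' = {}" and fW: "finite W'"
    using assms(2,3) x by (auto simp: W'_def)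
  define M where "M u v =
      (if u \<in> V \<and> v \<in> V then K u v else if u \<in> W \<and> v \<in> W then L u v
       else if u \<in> V then K u x * L x v else L u x * K x v)" for u v
  have MV: "M u v = K u v" if "u \<in> V" "v \<in> V" for u v using that by (simp add: M_def)
  have MW: "M u v = L u v" if "u \<in> W'" "v \<in> W'" for u v using that VW W by (auto simp: M_def)
  note Kxx = correlation_onD(2)[OF K(1) x(1)] and Lxx = correlation_onD(2)[OF L(1) x(2)]
  have MVW: "M u v = K u x * L x v" "M v u = L v x * K x u" if "u \<in> V" "v \<in> W'" for u v
    using that VW W Kxx Lxx assms(3) unfolding M_def by auto
  have psd: "0 \<le> quad_form (V \<union> W') M c" for c
  proof -
    define a where "a = (\<Sum>u\<in>V. c u * K u x)"
    define b where "b = (\<Sum>v\<in>W'. c v * L v x)"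
    define d where "d v = (if v = x then 0 else c v)" for v
    have d: "d v = c v" if "v \<in> W'" for v using that W by (auto simp: d_def)
    have [simp]: "d x = 0" by (simp add: d_def)
    have "(\<Sum>v\<in>W. d v * L v x) = b"
      unfolding W(1) b_def using fW W(2) by (simp add: d)
    then have b2: "b\<^sup>2 \<le> quad_form W L d"
      using quad_form_ge_square[OF assms(2) L(1) x(2), of d] by simp
    have Ld: "quad_form W L d = (\<Sum>u\<in>W'. \<Sum>v\<in>W'. c u * c v * L u v)"
      unfolding quad_form_def W(1)
      by (subst double_sum_Un[OF _ fW W(2)]) (simp_all add: d)
    have a2: "a\<^sup>2 \<le> quad_form V K c"
      unfolding a_def by (rule quad_form_ge_square[OF assms(1) K(1) x(1)])
    have ab1: "(\<Sum>u\<in>V. \<Sum>v\<in>W'. c u * c v * M u v) = a * b"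
    proof -
      have "(\<Sum>u\<in>V. \<Sum>v\<in>W'. c u * c v * M u v) = (\<Sum>u\<in>V. \<Sum>v\<in>W'. (c u * K u x) * (c v * L v x))"
      proof (intro sum.cong refl)
        fix u v assume "u \<in> V" "v \<in> W'"
        then show "c u * c v * M u v = (c u * K u x) * (c v * L v x)"
          using correlation_onD(1)[OF L(1) x(2), of v] W by (simp add: MVW)
      qed
      then show ?thesis by (simp add: a_def b_def sum_product)
    qed
    have ab2: "(\<Sum>u\<in>W'. \<Sum>v\<in>V. c u * c v * M u v) = b * a"
    proof -
      have "(\<Sum>u\<in>W'. \<Sum>v\<in>V. c u * c v * M u v) = (\<Sum>u\<in>W'. \<Sum>v\<in>V. (c u * L u x) * (c v * K v x))"
      proof (intro sum.cong refl)
        fix v u assume "u \<in> V" "v \<in> W'"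
        then show "c v * c u * M v u = (c v * L v x) * (c u * K u x)"
          using correlation_onD(1)[OF K(1) x(1), of u] by (simp add: MVW)
      qed
      then show ?thesis by (simp add: a_def b_def sum_product)
    qed
    \<comment> \<open>The cross terms are controlled by the parts of the two forms along the vector at \<open>x\<close>.\<close>
    have "quad_form (V \<union> W') M c = quad_form V K c + a * b + b * a + quad_form W L d"
      unfolding Ld unfolding quad_form_def double_sum_Un[OF assms(1) fW VW(2)] ab1 ab2
      by (simp add: MV MW)
    moreover have "0 \<le> (a + b)\<^sup>2" by simp
    ultimately show ?thesis using a2 b2 by (simp add: power2_sum algebra_simps)
  qed
  have "gain E (V \<union> W') M = gain E V K + gain E W L"
  proof -
    let ?g = "\<lambda>H u v. if E u v then - H u v / (1 - H u v) else 0 :: real"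
    have cross: "(\<Sum>u\<in>V. F u) = F x" if "\<And>u. u \<in> V - {x} \<Longrightarrow> F u = 0" for F :: "'a \<Rightarrow> real"
      using that assms(1) x by (subst sum.remove[OF assms(1) x(1)]) simp
    have 1: "(\<Sum>u\<in>V. \<Sum>v\<in>W'. ?g M u v) = (\<Sum>v\<in>W'. ?g L x v)"
      by (subst cross) (use E x Kxx in \<open>auto simp: W'_def[symmetric] MVW intro!: sum.neutral sum.cong\<close>)
    have 2: "(\<Sum>u\<in>W'. \<Sum>v\<in>V. ?g M u v) = (\<Sum>u\<in>W'. ?g L u x)"
    proof (intro sum.cong refl)
      fix w assume w: "w \<in> W'"
      show "(\<Sum>v\<in>V. ?g M w v) = ?g L w x"
        by (subst cross) (use E x Kxx w in \<open>auto simp: W'_def[symmetric] MVW\<close>)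
    qed
    have 3: "gain E W L = (\<Sum>v\<in>W'. ?g L x v) + (\<Sum>u\<in>W'. ?g L u x) + (\<Sum>u\<in>W'. \<Sum>v\<in>W'. ?g L u v)"
      unfolding gain_def W(1) by (subst double_sum_Un[OF _ fW W(2)]) (simp_all add: E(2))
    show ?thesis
      unfolding 3 unfolding gain_def double_sum_Un[OF assms(1) fW VW(2)] 1 2
      by (simp add: MV MW cong: if_cong)
  qed
  moreover have "M u v \<le> 0" if "u \<in> V \<union> W'" "v \<in> V \<union> W'" "E u v" for u v
  proof -
    consider "u \<in> V" "v \<in> V" | "u \<in> W'" "v \<in> W'" | "u \<in> V" "v \<in> W'" | "u \<in> W'" "v \<in> V"
      using \<open>u \<in> V \<union> W'\<close> \<open>v \<in> V \<union> W'\<close> by blast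
    then show ?thesis
    proof cases
      case 1 then show ?thesis using K(2) that by (simp add: MV)
    next
      case 2 then show ?thesis using L(2) that W by (simp add: MW)
    next
      case 3
      then have "u = x" using E(1) that by (auto simp: W'_def)
      then show ?thesis using L(2)[of x v] 3 that W Kxx by (simp add: MVW)
    next
      case 4
      then have "v = x" using E(1) that by (auto simp: W'_def)
      then show ?thesis using L(2)[of u x] 4 that W Kxx by (simp add: MVW)
    qed
  qed
  moreover have "correlation_on (V \<union> W') M"
  proof -
    have "M u v = M v u" if "u \<in> V \<union> W'" "v \<in> V \<union> W'" for u v
    proof -
      have *: "M a b = M b a" if "a \<in> V" "b \<in> W'" for a b
        using that x W correlation_onD(1)[OF K(1), of a x] correlation_onD(1)[OF L(1), of b x] by (simp add: MVW)
      show ?thesis using that *[of u v] *[of v u]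
        correlation_onD(1)[OF K(1), of u v] correlation_onD(1)[OF L(1), of u v] W MV[of u v] MV[of v u] MW[of u v] MW[of v u] by auto
    qed
    moreover have "M v v = 1" if "v \<in> V \<union> W'" for v
      using that correlation_onD(2)[OF K(1)] correlation_onD(2)[OF L(1)] W MV MW by auto
    ultimately show ?thesis using psd by (auto simp: correlation_on_def)
  qed
  ultimately show ?thesis unfolding VW(1) using K(3) L(3) by (intro certifiesI[of _ M]) auto
qed


lemma certifies_singleton:
  assumes "\<not> E v v"
  shows "certifies E {v} 0"
  using assms by (intro certifiesI[of _ "\<lambda>_ _. 1"]) (auto simp: correlation_on_def quad_form_def gain_def)

lemma certifies_edge:
  assumes "E u v" "E v u" "\<not> E u u" "\<not> E v v"
  shows "certifies E {u, v} 1"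
proof -
  have uv: "u \<noteq> v" using assms by auto
  let ?K = "\<lambda>x y. if x = y then 1 else - 1 :: real"
  have "quad_form {u, v} ?K c = (c u - c v)\<^sup>2" for c
    using uv by (simp add: quad_form_def power2_eq_square algebra_simps)
  then show ?thesis
    using assms uv by (intro certifiesI[of _ ?K]) (auto simp: correlation_on_def gain_def)
qed

text \<open>
  Jensen's inequality for the concave function \<open>x / (1 + x)\<close>.
\<close>

lemma sum_divide_one_plus_le:
  fixes a :: "'b \<Rightarrow> real"
  assumes "finite I" "I \<noteq> {}" "\<And>i. i \<in> I \<Longrightarrow> 0 \<le> a i"
  shows "(\<Sum>i\<in>I. a i / (1 + a i)) \<le> card I * sum a I / (card I + sum a I)"
proof -
  define k where "k = real (card I)"
  define s where "s = sum a I"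
  have k: "k > 0" using assms by (simp add: k_def card_gt_0_iff)
  have s: "s \<ge> 0" using assms by (simp add: s_def sum_nonneg)
  define c where "c = k / (k + s)"
  \<comment> \<open>The tangent at the mean of the \<open>a i\<close>, for which \<open>1 / (1 + a i)\<close> equals \<open>c\<close>.\<close>
  have "a i / (1 + a i) \<le> 1 - 2 * c + c\<^sup>2 * (1 + a i)" if "i \<in> I" for i
  proof -
    have pos: "1 + a i > 0" using assms(3)[OF that] by simp
    have "0 \<le> (c * (1 + a i) - 1)\<^sup>2" by simp
    then have "a i \<le> (1 - 2 * c + c\<^sup>2 * (1 + a i)) * (1 + a i)"
      by (simp add: power2_eq_square algebra_simps)
    then show ?thesis using pos by (simp add: pos_divide_le_eq)
  qed
  then have "(\<Sum>i\<in>I. a i / (1 + a i)) \<le> (\<Sum>i\<in>I. 1 - 2 * c + c\<^sup>2 * (1 + a i))"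
    by (rule sum_mono)
  also have "\<dots> = k * (1 - 2 * c) + c\<^sup>2 * (k + s)"
    by (simp add: sum.distrib sum_distrib_left[symmetric] k_def s_def)
  also have "\<dots> = k - 2 * c * k + c * (c * (k + s))" by (simp add: power2_eq_square algebra_simps)
  also have ck: "c * (k + s) = k" using k s by (simp add: c_def)
  also have "k - 2 * c * k + c * k = c * s" using ck by (simp add: algebra_simps)
  also have "\<dots> = k * s / (k + s)" by (simp add: c_def)
  finally show ?thesis by (simp add: k_def s_def)
qed

text \<open>
  As a function of \<open>t = k * s / (k + s)\<close>, the right-hand side is convex, and the left-hand side is its
  tangent at \<open>s = 1\<close>. In the averaging argument this is the value of \<open>s\<close> for the complete graph on
  \<open>k + 2\<close> vertices: \<open>k\<close> vertex deletions spare a given edge, each with \<open>\<kappa> = 1 / k\<close>.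
\<close>

lemma tangent_bound:
  fixes k s :: real
  assumes "k > 0" "s \<ge> 0"
  shows "(k + 1) ^ 3 / ((k + 2)\<^sup>2 * k\<^sup>2) * (k * s / (k + s)) - 1 / ((k + 2)\<^sup>2 * k) \<le> s / (k + 1 + s)"
proof -
  have "s / (k + 1 + s) - ((k + 1) ^ 3 / ((k + 2)\<^sup>2 * k\<^sup>2) * (k * s / (k + s)) - 1 / ((k + 2)\<^sup>2 * k))
      = (k + 1) * (s - 1)\<^sup>2 / ((k + 2)\<^sup>2 * (k + 1 + s) * (k + s))"
  proof -
    have "k + 1 + s \<noteq> 0" "k + s \<noteq> 0" "k + 2 \<noteq> 0" "k \<noteq> 0" using assms by auto
    then show ?thesis by (simp add: divide_simps) (simp add: algebra_simps power2_eq_square power3_eq_cube)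
  qed
  also have "\<dots> \<ge> 0" using assms by (intro divide_nonneg_nonneg mult_nonneg_nonneg) auto
  finally show ?thesis by simp
qed

text \<open>
  The matrix for \<open>V\<close> is the sum of the matrices for the sets \<open>V - {v}\<close>, divided by \<open>k + 1\<close> and not by
  the number \<open>k + 2\<close> of summands: a diagonal entry is missing from exactly one of them. An edge is
  missing from two of them, so its \<open>\<kappa>\<close> drops by the factor \<open>k / (k + 1)\<close> from the mean over the
  others. Jensen's inequality and the tangent bound compare the new gain of an edge with the sum
  of its old gains by an affine inequality with equality for the complete graph. Summing it over
  all edges, at most all pairs of distinct vertices, gives the claim; having fewer edges only helps,
  because the constant term \<open>\<beta>\<close> is subtracted for every pair.
\<close>

lemma certifies_from_vertex_deletions:
  assumes "finite V" "card V = k + 2" "k > 0" "\<And>v. \<not> E v v"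
    and del: "\<And>v. v \<in> V \<Longrightarrow> certifies E (V - {v}) (real k)"
  shows "certifies E V (real k + 1)"
proof -
  from del have "\<forall>v. \<exists>K. v \<in> V \<longrightarrow> correlation_on (V - {v}) K
      \<and> (\<forall>u\<in>V - {v}. \<forall>w\<in>V - {v}. E u w \<longrightarrow> K u w \<le> 0) \<and> real k \<le> gain E (V - {v}) K"
    by (auto simp: certifies_def)
  then obtain K where K: "\<And>v. v \<in> V \<Longrightarrow> correlation_on (V - {v}) (K v)"
    "\<And>v u w. v \<in> V \<Longrightarrow> u \<in> V - {v} \<Longrightarrow> w \<in> V - {v} \<Longrightarrow> E u w \<Longrightarrow> K v u w \<le> 0"
    "\<And>v. v \<in> V \<Longrightarrow> real k \<le> gain E (V - {v}) (K v)"
    by metis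
  define M where "M u w = (\<Sum>v\<in>V - {u, w}. K v u w) / (real k + 1)" for u w
  have swap: "(\<Sum>u\<in>V. \<Sum>w\<in>V. \<Sum>v\<in>V - {u, w}. f v u w) = (\<Sum>v\<in>V. \<Sum>u\<in>V - {v}. \<Sum>w\<in>V - {v}. f v u w)"
    for f :: "'a \<Rightarrow> 'a \<Rightarrow> 'a \<Rightarrow> real"
  proof -
    have "(\<Sum>u\<in>V. \<Sum>w\<in>V. \<Sum>v\<in>V - {u, w}. f v u w)
        = (\<Sum>u\<in>V. \<Sum>w\<in>V. \<Sum>v\<in>V. if v \<noteq> u \<and> v \<noteq> w then f v u w else 0)"
      using assms(1) by (intro sum.cong refl sum.mono_neutral_cong_left) auto
    also have "\<dots> = (\<Sum>u\<in>V. \<Sum>v\<in>V. \<Sum>w\<in>V. if v \<noteq> u \<and> v \<noteq> w then f v u w else 0)"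
      by (intro sum.cong refl sum.swap)
    also have "\<dots> = (\<Sum>v\<in>V. \<Sum>u\<in>V. \<Sum>w\<in>V. if v \<noteq> u \<and> v \<noteq> w then f v u w else 0)"
      by (rule sum.swap)
    also have "\<dots> = (\<Sum>v\<in>V. \<Sum>u\<in>V - {v}. \<Sum>w\<in>V. if v \<noteq> u \<and> v \<noteq> w then f v u w else 0)"
      using assms(1) by (intro sum.cong refl sum.mono_neutral_cong_right) auto
    also have "\<dots> = (\<Sum>v\<in>V. \<Sum>u\<in>V - {v}. \<Sum>w\<in>V - {v}. f v u w)"
      using assms(1) by (intro sum.cong refl sum.mono_neutral_cong_right) auto
    finally show ?thesis .
  qed
  have corr: "correlation_on V M"
    unfolding correlation_on_def
  proof (intro conjI ballI allI)
    fix u w assume "u \<in> V" "w \<in> V"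
    then show "M u w = M w u"
      unfolding M_def insert_commute[of u w]
      using correlation_onD(1)[OF K(1)] by (intro arg_cong[where f = "\<lambda>y. y / _"] sum.cong) auto
  next
    fix v assume v: "v \<in> V"
    have "(\<Sum>u\<in>V - {v, v}. K u v v) = (\<Sum>u\<in>V - {v}. 1)"
      using correlation_onD(2)[OF K(1)] v by (intro sum.cong) auto
    also have "\<dots> = real k + 1" using assms(1,2) v by simp
    finally show "M v v = 1" by (simp add: M_def)
  next
    fix c
    have "quad_form V M c = (\<Sum>u\<in>V. \<Sum>w\<in>V. \<Sum>v\<in>V - {u, w}. c u * c w * K v u w / (real k + 1))"
      unfolding quad_form_def M_def by (simp add: sum_distrib_left sum_divide_distrib)
    also have "\<dots> = (\<Sum>v\<in>V. quad_form (V - {v}) (K v) c / (real k + 1))"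
      unfolding swap quad_form_def by (simp add: sum_divide_distrib)
    also have "\<dots> \<ge> 0"
      using correlation_onD(3)[OF K(1)] by (intro sum_nonneg divide_nonneg_nonneg) auto
    finally show "0 \<le> quad_form V M c" .
  qed
  define \<alpha> where "\<alpha> = (real k + 1) ^ 3 / ((real k + 2)\<^sup>2 * (real k)\<^sup>2)"
  define \<beta> where "\<beta> = 1 / ((real k + 2)\<^sup>2 * real k)"
  have \<beta>: "\<beta> \<ge> 0" by (simp add: \<beta>_def)
  have \<alpha>: "\<alpha> \<ge> 0" by (simp add: \<alpha>_def)
  let ?g = "\<lambda>v u w. if E u w then - K v u w / (1 - K v u w) else 0"
  have edge: "\<alpha> * (\<Sum>v\<in>V - {u, w}. ?g v u w) - (if u \<noteq> w then \<beta> else 0)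
      \<le> (if E u w then - M u w / (1 - M u w) else 0)" if uw: "u \<in> V" "w \<in> V" for u w
  proof (cases "E u w")
    case False
    then show ?thesis using \<beta> by simp
  next
    case True
    then have "u \<noteq> w" using assms(4) by metis
    then have card: "card (V - {u, w}) = k" using assms(1,2) uw by (simp add: card_Diff_subset)
    define a where "a v = - K v u w" for v
    define s where "s = sum a (V - {u, w})"
    have a: "0 \<le> a v" if "v \<in> V - {u, w}" for v
      using K(2)[of v u w] that uw True by (auto simp: a_def)
    have s: "s \<ge> 0" unfolding s_def by (rule sum_nonneg) (rule a)
    have "(\<Sum>v\<in>V - {u, w}. ?g v u w) = (\<Sum>v\<in>V - {u, w}. a v / (1 + a v))"
      using True by (simp add: a_def)
    also have "\<dots> \<le> k * s / (k + s)"
      using sum_divide_one_plus_le[of "V - {u, w}" a, OF _ _ a] card assms(1,3) unfolding s_def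
      by (metis card.empty finite_Diff less_numeral_extra(3))
    finally have "\<alpha> * (\<Sum>v\<in>V - {u, w}. ?g v u w) \<le> \<alpha> * (k * s / (k + s))"
      using \<alpha> by (rule mult_left_mono)
    moreover have "\<alpha> * (k * s / (k + s)) - \<beta> \<le> s / (real k + 1 + s)"
      unfolding \<alpha>_def \<beta>_def using assms(3) s by (intro tangent_bound) auto
    moreover have "- M u w / (1 - M u w) = s / (real k + 1 + s)"
    proof -
      have M: "M u w = - s / (real k + 1)" by (simp add: M_def s_def a_def sum_negf)
      show ?thesis unfolding M using s by (simp add: divide_simps)
    qed
    ultimately show ?thesis using True \<open>u \<noteq> w\<close> by simp
  qed
  have pairs: "(\<Sum>u\<in>V. \<Sum>w\<in>V. if u \<noteq> w then \<beta> else 0) = (real k + 2) * (real k + 1) * \<beta>"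
  proof -
    have "(\<Sum>w\<in>V. if u \<noteq> w then \<beta> else 0) = (k + 1) * \<beta>" if "u \<in> V" for u
    proof -
      have "(\<Sum>w\<in>V. if u \<noteq> w then \<beta> else 0) = (\<Sum>w\<in>V - {u}. \<beta>)"
        using assms(1) by (intro sum.mono_neutral_cong_right) auto
      then show ?thesis using assms(1,2) that by simp
    qed
    then show ?thesis using assms(2) by (simp add: algebra_simps)
  qed
  have "real k + 1 = \<alpha> * ((real k + 2) * real k) - (real k + 2) * (real k + 1) * \<beta>"
    using assms(3) unfolding \<alpha>_def \<beta>_def
    by (simp add: divide_simps) (simp add: algebra_simps power2_eq_square power3_eq_cube)
  also have "\<dots> \<le> \<alpha> * (\<Sum>v\<in>V. gain E (V - {v}) (K v)) - (real k + 2) * (real k + 1) * \<beta>"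
  proof -
    have "(\<Sum>v\<in>V. real k) \<le> (\<Sum>v\<in>V. gain E (V - {v}) (K v))" by (rule sum_mono) (rule K(3))
    then have "(real k + 2) * real k \<le> (\<Sum>v\<in>V. gain E (V - {v}) (K v))" using assms(2) by (simp add: algebra_simps)
    from mult_left_mono[OF this \<alpha>] show ?thesis by simp
  qed
  also have "\<dots> = (\<Sum>u\<in>V. \<Sum>w\<in>V. \<alpha> * (\<Sum>v\<in>V - {u, w}. ?g v u w) - (if u \<noteq> w then \<beta> else 0))"
    unfolding sum_subtractf pairs sum_distrib_left[symmetric] swap gain_def by simp
  also have "\<dots> \<le> gain E V M"
    unfolding gain_def by (intro sum_mono edge)
  finally have "real k + 1 \<le> gain E V M" .
  moreover have "M u w \<le> 0" if "u \<in> V" "w \<in> V" "E u w" for u w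
    unfolding M_def using K(2) that by (intro divide_nonpos_nonneg sum_nonpos) auto
  ultimately show ?thesis using corr by (intro certifiesI[of _ M]) auto
qed


section \<open>Certificates for connected graphs\<close>

text \<open>
  Connectedness of the subgraph induced on \<open>V\<close>, in terms of cuts: this form passes to the two sides
  of a cut vertex without following paths.
\<close>

definition linked :: "('a \<Rightarrow> 'a \<Rightarrow> bool) \<Rightarrow> 'a set \<Rightarrow> bool" where
  "linked E V \<longleftrightarrow> V \<noteq> {} \<and> (\<forall>S. S \<subset> V \<and> S \<noteq> {} \<longrightarrow> (\<exists>u\<in>S. \<exists>w\<in>V - S. E u w))"

text \<open>
  A union \<open>S\<close> of components that arise by deleting \<open>x\<close> is again connected together with \<open>x\<close>. A cut of
  \<open>insert x S\<close> has one side inside \<open>S\<close>, and an edge of \<open>V\<close> leaving that side cannot leave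
  \<open>insert x S\<close>.
\<close>

lemma linked_insert_part:
  assumes "linked E V" "\<And>u v. E u v \<Longrightarrow> E v u" "x \<in> V"
    and S: "S \<subset> V - {x}" "\<And>u w. u \<in> S \<Longrightarrow> w \<in> V - {x} - S \<Longrightarrow> \<not> E u w"
  shows "linked E (insert x S)"
  unfolding linked_def
proof (intro conjI allI impI)
  fix T assume T: "T \<subset> insert x S \<and> T \<noteq> {}"
  have inside: "\<exists>u\<in>R. \<exists>w\<in>insert x S - R. E u w" if R: "R \<subseteq> S" "R \<noteq> {}" for R
  proof -
    have "R \<subset> V" using R S(1) assms(3) by auto
    then obtain u w where uw: "u \<in> R" "w \<in> V - R" "E u w"
      using assms(1) R(2) unfolding linked_def by blast
    then have "w \<in> insert x S - R" using S(2)[of u w] R(1) by auto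
    then show ?thesis using uw by blast
  qed
  show "\<exists>u\<in>T. \<exists>w\<in>insert x S - T. E u w"
  proof (cases "x \<in> T")
    case False
    then show ?thesis using inside[of T] T by auto
  next
    case True
    obtain u w where "u \<in> insert x S - T" "w \<in> insert x S - (insert x S - T)" "E u w"
      using inside[of "insert x S - T"] T True by blast
    then show ?thesis using T assms(2) by blast
  qed
qed auto

text \<open>
  Either every vertex deletion leaves a connected graph, and averaging applies, or some vertex
  splits the graph into two smaller connected graphs that share only this vertex, and their
  certificates are glued.
\<close>

lemma linked_certifies:
  assumes "finite V" "linked E V" "\<And>u v. E u v \<Longrightarrow> E v u" "\<And>v. \<not> E v v"
  shows "certifies E V (real (card V) - 1)"
  using assms(1,2)
proof (induction "card V" arbitrary: V rule: less_induct)
  case less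
  note fin = less.prems(1) and link = less.prems(2)
  have "V \<noteq> {}" using link by (simp add: linked_def)
  then have "card V \<noteq> 0" using fin by simp
  then consider "card V = 1" | "card V = 2" | "card V \<ge> 3" by linarith
  then show ?case
  proof cases
    case 1
    then obtain v where "V = {v}" by (auto simp: card_1_singleton_iff)
    then show ?thesis using certifies_singleton[of E v] assms(4) by simp
  next
    case 2
    then obtain u v where V: "V = {u, v}" "u \<noteq> v" by (auto simp: card_2_iff)
    then have "E u v" using link[unfolded linked_def, THEN conjunct2, rule_format, of "{u}"] by auto
    then show ?thesis using certifies_edge[of E u v] assms(3,4) V by simp
  next
    case 3
    show ?thesis
    proof (cases "\<forall>x\<in>V. linked E (V - {x})")
      case True
      have "certifies E V (real (card V - 2) + 1)"
      proof (rule certifies_from_vertex_deletions)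
        fix x assume x: "x \<in> V"
        have "card (V - {x}) < card V" using fin x by (rule card_Diff1_less)
        then have "certifies E (V - {x}) (real (card (V - {x})) - 1)"
          using less.hyps True fin x by blast
        then show "certifies E (V - {x}) (real (card V - 2))"
          using fin x 3 by (simp add: of_nat_diff)
      qed (use fin 3 assms(4) in auto)
      then show ?thesis using 3 by (simp add: of_nat_diff)
    next
      case False
      then obtain x where x: "x \<in> V" "\<not> linked E (V - {x})" by auto
      have "card (V - {x}) \<ge> 2" using 3 fin x(1) by simp
      then have "V - {x} \<noteq> {}" by (metis card.empty not_numeral_le_zero)
      then obtain S where S: "S \<subset> V - {x}" "S \<noteq> {}" "\<And>u w. u \<in> S \<Longrightarrow> w \<in> V - {x} - S \<Longrightarrow> \<not> E u w"
        using x(2) unfolding linked_def by blast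
      define T where "T = V - {x} - S"
      have T: "T \<subset> V - {x}" "T \<noteq> {}" "\<And>u w. u \<in> T \<Longrightarrow> w \<in> V - {x} - T \<Longrightarrow> \<not> E u w"
        using S assms(3) unfolding T_def by blast+
      have fS: "finite S" "finite T" using S(1) T(1) fin by (auto intro: finite_subset)
      have part: "V = insert x S \<union> insert x T" "insert x S \<inter> insert x T = {x}" "S \<inter> T = {}" "x \<notin> S" "x \<notin> T"
        using S(1) x(1) by (auto simp: T_def)
      have card: "card V = card S + card T + 1"
        using part fS by (simp add: card_Un_disjoint insert_absorb Un_insert_right)
      have pos: "card S > 0" "card T > 0" using S(2) T(2) fS by (auto simp: card_gt_0_iff)
      have "certifies E (insert x S) (real (card (insert x S)) - 1)"
      proof (rule less.hyps)
        show "linked E (insert x S)"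
          by (rule linked_insert_part[OF link assms(3) x(1) S(1)]) (simp, rule S(3))
      qed (use part fS card pos in auto)
      moreover have "certifies E (insert x T) (real (card (insert x T)) - 1)"
      proof (rule less.hyps)
        show "linked E (insert x T)"
          by (rule linked_insert_part[OF link assms(3) x(1) T(1)]) (simp, rule T(3))
      qed (use part fS card pos in auto)
      ultimately have "certifies E (insert x S \<union> insert x T)
          ((real (card (insert x S)) - 1) + (real (card (insert x T)) - 1))"
      proof (intro certifies_glue[of _ _ x])
        show "finite (insert x S)" "finite (insert x T)" using fS by auto
        show "\<not> E x x" by (rule assms(4))
        fix u w assume "u \<in> insert x S - {x}" "w \<in> insert x T - {x}"
        then have "u \<in> S" "w \<in> T" by auto
        then have "\<not> E u w" using S(3) by (simp add: T_def)
        then show "\<not> E u w \<and> \<not> E w u" using assms(3) by blast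
      qed (use part in auto)
      then have "certifies E (insert x S \<union> insert x T) (real (card S) + real (card T))"
        using part fS by simp
      then show ?thesis using part(1) card by simp
    qed
  qed
qed

section \<open>Certificates for arbitrary graphs\<close>

lemma certifies_Union:
  assumes "finite \<C>" "\<And>C. C \<in> \<C> \<Longrightarrow> finite C \<and> certifies E C (r C)"
    and "\<And>C D. C \<in> \<C> \<Longrightarrow> D \<in> \<C> \<Longrightarrow> C \<noteq> D \<Longrightarrow> C \<inter> D = {}"
  shows "certifies E (\<Union>\<C>) (\<Sum>C\<in>\<C>. r C)"
  using assms
proof (induction \<C> rule: finite_induct)
  case empty
  show ?case by (simp add: certifies_def correlation_on_def quad_form_def gain_def)
next
  case (insert C \<C>)
  have "C \<inter> \<Union>\<C> = {}" using insert.prems(2)[of C] insert.hyps(2) by blast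
  then have "certifies E (C \<union> \<Union>\<C>) (r C + (\<Sum>C\<in>\<C>. r C))"
    using insert by (intro certifies_disjoint_Un) auto
  then show ?case using insert.hyps by simp
qed

context pair_graph
begin

lemma reachable_cut_arc:
  assumes "u \<rightarrow>\<^sup>*\<^bsub>with_proj G\<^esub> w" "u \<in> S" "w \<notin> S"
  shows "\<exists>a\<in>S. \<exists>b. b \<notin> S \<and> (a, b) \<in> parcs G \<and> u \<rightarrow>\<^sup>*\<^bsub>with_proj G\<^esub> a \<and> u \<rightarrow>\<^sup>*\<^bsub>with_proj G\<^esub> b"
  using assms
proof (induction rule: reachable_induct)
  case base
  then show ?case by simp
next
  case (step a b)
  show ?case
  proof (cases "a \<in> S")
    case True
    moreover have "(a, b) \<in> parcs G" using step(2) by (auto simp: with_proj_def)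
    ultimately show ?thesis using step by (meson reachable_adj_trans)
  next
    case False
    then show ?thesis using step by blast
  qed
qed

text \<open>
  A path between two vertices of a component may only visit vertices of it, because arcs can be
  traversed in both directions. So the arc on which such a path leaves a part of the component ends
  in the component again.
\<close>

lemma linked_scc:
  assumes "S \<in> pre_digraph.sccs_verts (with_proj G)"
  shows "linked (\<lambda>u v. (u, v) \<in> parcs G) S"
  unfolding linked_def
proof (intro conjI allI impI)
  have S: "S \<noteq> {}" "\<And>u v. u \<in> S \<Longrightarrow> v \<in> S \<Longrightarrow> u \<rightarrow>\<^sup>*\<^bsub>with_proj G\<^esub> v"
    "\<And>u v. u \<in> S \<Longrightarrow> v \<notin> S \<Longrightarrow> \<not> u \<rightarrow>\<^sup>*\<^bsub>with_proj G\<^esub> v \<or> \<not> v \<rightarrow>\<^sup>*\<^bsub>with_proj G\<^esub> u"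
    using assms by (auto simp: pre_digraph.sccs_verts_def)
  show "S \<noteq> {}" by (rule S(1))
  fix T assume T: "T \<subset> S \<and> T \<noteq> {}"
  then obtain u w where uw: "u \<in> T" "w \<in> S" "w \<notin> T" by blast
  have "u \<rightarrow>\<^sup>*\<^bsub>with_proj G\<^esub> w" using S(2) uw T by blast
  then obtain a b where ab: "a \<in> T" "b \<notin> T" "(a, b) \<in> parcs G" "u \<rightarrow>\<^sup>*\<^bsub>with_proj G\<^esub> b"
    using reachable_cut_arc uw by blast
  have "b \<rightarrow>\<^sup>*\<^bsub>with_proj G\<^esub> u" using ab(4) by (rule symmetric_reachable'[rotated])
  then have "b \<in> S" using S(3)[of u b] ab(4) uw T by blast
  then show "\<exists>u\<in>T. \<exists>w\<in>S - T. (u, w) \<in> parcs G" using ab by blast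
qed

end

lemma (in pair_graph) certifies_verts:
  "certifies (\<lambda>u v. (u, v) \<in> parcs G) (pverts G) (real (card (pverts G)) - real (num_components G))"
proof -
  let ?E = "\<lambda>u v. (u, v) \<in> parcs G" and ?C = "pre_digraph.sccs_verts (with_proj G)"
  have Esym: "?E v u" if "?E u v" for u v using arcs_symmetric that by blast
  have Eirr: "\<not> ?E v v" for v by (rule notI) (drule no_loops, simp)
  have fin: "finite ?C" by (rule finite_sccs_verts)
  have sub: "S \<subseteq> pverts G" if "S \<in> ?C" for S using sccs_verts_subsets[OF that] by simp
  have disj: "S \<inter> T = {}" if "S \<in> ?C" "T \<in> ?C" "S \<noteq> T" for S T using sccs_verts_disjoint[OF that] .
  have un: "\<Union>?C = pverts G"
  proof
    show "pverts G \<subseteq> \<Union>?C"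
    proof
      fix v assume "v \<in> pverts G"
      then show "v \<in> \<Union>?C" using scc_of_in_sccs_verts in_scc_of_self by blast
    qed
  qed (use sub in blast)
  have finS: "finite S" if "S \<in> ?C" for S using sub[OF that] finite_verts by (auto intro: finite_subset)
  have "certifies ?E (\<Union>?C) (\<Sum>S\<in>?C. real (card S) - 1)"
    using fin disj finS linked_certifies[OF _ linked_scc Esym Eirr] by (intro certifies_Union) auto
  also have "(\<Sum>S\<in>?C. real (card S) - 1) = real (card (\<Union>?C)) - real (card ?C)"
    using card_Union_disjoint[of ?C] disj finS
    by (simp add: sum_subtractf pairwise_def disjnt_def)
  finally show ?thesis unfolding un num_components_def card_sccs_verts .
qed

lemma certifies_reindex:
  assumes "bij_betw f I V" "certifies E V r"
  shows "certifies (\<lambda>i j. E (f i) (f j)) I r"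
proof -
  obtain K where K: "correlation_on V K" "\<And>u v. u \<in> V \<Longrightarrow> v \<in> V \<Longrightarrow> E u v \<Longrightarrow> K u v \<le> 0" "r \<le> gain E V K"
    using assms(2) unfolding certifies_def by blast
  let ?g = "the_inv_into I f"
  have fV: "f i \<in> V" if "i \<in> I" for i using assms(1) that by (auto simp: bij_betw_def)
  have gf: "?g (f i) = i" if "i \<in> I" for i
    using assms(1) that by (simp add: bij_betw_def the_inv_into_f_f)
  have re: "(\<Sum>i\<in>I. \<Sum>j\<in>I. F (f i) (f j)) = (\<Sum>u\<in>V. \<Sum>v\<in>V. F u v)" for F :: "'b \<Rightarrow> 'b \<Rightarrow> real"
    using sum.reindex_bij_betw[OF assms(1), of "\<lambda>u. \<Sum>v\<in>V. F u v"]
    by (simp add: sum.reindex_bij_betw[OF assms(1), symmetric])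
  have "quad_form I (\<lambda>i j. K (f i) (f j)) c = quad_form V K (\<lambda>v. c (?g v))" for c
    using re[of "\<lambda>u v. c (?g u) * c (?g v) * K u v"] by (simp add: quad_form_def gf cong: sum.cong)
  then have "correlation_on I (\<lambda>i j. K (f i) (f j))"
    using K(1) fV by (auto simp: correlation_on_def)
  moreover have "gain (\<lambda>i j. E (f i) (f j)) I (\<lambda>i j. K (f i) (f j)) = gain E V K"
    unfolding gain_def by (rule re[of "\<lambda>u v. if E u v then - K u v / (1 - K u v) else 0"])
  ultimately show ?thesis using K fV by (intro certifiesI) auto
qed

section \<open>The spectral theorem for real symmetric matrices\<close>

text \<open>
  A complex eigenvalue exists by the fundamental theorem of algebra. It is the quotient of the
  Hermitian form of \<open>A\<close> and the squared norm at an eigenvector, both of which are real.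
\<close>

lemma symmetric_mat_real_eigenvalue:
  fixes A :: "real mat"
  assumes A: "A \<in> carrier_mat n n" and sym: "transpose_mat A = A" and n: "n > 0"
  shows "\<exists>e. eigenvalue A e"
proof -
  let ?C = "map_mat complex_of_real A"
  have C: "?C \<in> carrier_mat n n" using A by simp
  have "degree (char_poly ?C) = n" using degree_monic_char_poly[OF C] by simp
  then have "\<not> constant (poly (char_poly ?C))" using n by (simp add: constant_degree)
  then obtain \<mu> where "poly (char_poly ?C) \<mu> = 0" using fundamental_theorem_of_algebra by blast
  then have root: "eigenvalue ?C \<mu>" using eigenvalue_root_char_poly[OF C] by simp
  then obtain v where v: "v \<in> carrier_vec n" "v \<noteq> 0\<^sub>v n" "?C *\<^sub>v v = \<mu> \<cdot>\<^sub>v v"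
    using C unfolding eigenvalue_def eigenvector_def by auto
  define q where "q = (\<Sum>i<n. \<Sum>j<n. complex_of_real (A $$ (i, j)) * v $ j * cnj (v $ i))"
  define N where "N = (\<Sum>i<n. (cmod (v $ i))\<^sup>2)"
  have Aij: "A $$ (i, j) = A $$ (j, i)" if "i < n" "j < n" for i j
    using arg_cong[OF sym, of "\<lambda>M. M $$ (i, j)"] A that by simp
  have "cnj q = (\<Sum>i<n. \<Sum>j<n. complex_of_real (A $$ (i, j)) * v $ i * cnj (v $ j))"
    by (simp add: q_def mult_ac)
  also have "\<dots> = (\<Sum>j<n. \<Sum>i<n. complex_of_real (A $$ (i, j)) * v $ i * cnj (v $ j))" by (rule sum.swap)
  also have "\<dots> = q" unfolding q_def by (intro sum.cong refl) (auto simp: Aij)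
  finally have cq: "cnj q = q" .
  have row: "(\<Sum>j<n. complex_of_real (A $$ (i, j)) * v $ j) = \<mu> * v $ i" if "i < n" for i
    using arg_cong[OF v(3), of "\<lambda>w. w $ i"] that A v(1) by (simp add: scalar_prod_def lessThan_atLeast0)
  have "q = (\<Sum>i<n. (\<Sum>j<n. complex_of_real (A $$ (i, j)) * v $ j) * cnj (v $ i))"
    by (simp add: q_def sum_distrib_right)
  also have "\<dots> = (\<Sum>i<n. \<mu> * complex_of_real ((cmod (v $ i))\<^sup>2))"
    by (intro sum.cong refl) (simp only: row complex_norm_square mult.assoc lessThan_iff)
  finally have qN: "q = \<mu> * complex_of_real N" by (simp add: N_def sum_distrib_left)
  have "N \<noteq> 0"
  proof
    assume "N = 0"
    then have "v $ i = 0" if "i < n" for i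
      using that by (simp add: N_def sum_nonneg_eq_0_iff)
    then show False using v(1,2) by (metis eq_vecI carrier_vecD index_zero_vec)
  qed
  then have "cnj \<mu> = \<mu>" using cq qN by simp
  then have "\<mu> \<in> \<real>" by (simp add: Reals_cnj_iff)
  then have \<mu>: "\<mu> = complex_of_real (Re \<mu>)" by simp
  have "poly (char_poly ?C) (complex_of_real (Re \<mu>)) = complex_of_real (poly (char_poly A) (Re \<mu>))"
    unfolding of_real_hom.char_poly_hom[OF A] by (rule of_real_hom.poly_map_poly)
  then have "poly (char_poly A) (Re \<mu>) = 0"
    using root \<mu> eigenvalue_root_char_poly[OF C] by simp
  then show ?thesis using eigenvalue_root_char_poly[OF A] by blast
qed

lemma orthonormal_matrix_with_first_column:
  fixes v :: "real vec"
  assumes v: "v \<in> carrier_vec n" "v \<noteq> 0\<^sub>v n"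
  shows "\<exists>U c. U \<in> carrier_mat n n \<and> transpose_mat U * U = 1\<^sub>m n \<and> col U 0 = c \<cdot>\<^sub>v v"
proof -
  interpret cof_vec_space n "TYPE(real)" .
  define b where "b = basis_completion v"
  define ws where "ws = gram_schmidt n b"
  have n: "n > 0" using v by (cases n) auto
  note b = basis_completion[OF v, folded b_def]
  obtain vs where bv: "b = v # vs" using b(6,7) n by (cases b) auto
  have ws: "set ws \<subseteq> carrier_vec n" "corthogonal ws" "length ws = n"
    using gram_schmidt_result[OF b(2) b(4) b(5) refl, folded ws_def] b(6) by auto
  have hd: "hd ws = v" using gram_schmidt_hd[OF v(1), of vs, folded bv] by (simp add: ws_def)
  have wi: "ws ! i \<in> carrier_vec n" if "i < n" for i using ws that by auto
  have conj: "conjugate w = w" for w :: "real vec" by (rule eq_vecI) auto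
  have orth: "(ws ! i \<bullet> ws ! j = 0) = (i \<noteq> j)" if "i < n" "j < n" for i j
    using corthogonalD[OF ws(2), of i j] ws(3) that by (simp add: conj)
  define r where "r i = 1 / sqrt (ws ! i \<bullet> ws ! i)" for i
  define U where "U = mat_of_cols n (map (\<lambda>i. r i \<cdot>\<^sub>v ws ! i) [0..<n])"
  have U: "U \<in> carrier_mat n n"
    using mat_of_cols_carrier(1)[of n "map (\<lambda>i. r i \<cdot>\<^sub>v ws ! i) [0..<n]"] by (simp add: U_def)
  have col: "col U i = r i \<cdot>\<^sub>v ws ! i" if "i < n" for i
    using that wi[OF that] by (simp add: U_def col_mat_of_cols)
  have pos: "ws ! i \<bullet> ws ! i > 0" if "i < n" for i
  proof -
    have "ws ! i \<bullet> ws ! i \<ge> 0" unfolding scalar_prod_def by (rule sum_nonneg) simp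
    then show ?thesis using orth[OF that that] by linarith
  qed
  have "transpose_mat U * U = 1\<^sub>m n"
  proof (rule eq_matI)
    fix i j assume "i < dim_row (1\<^sub>m n :: real mat)" "j < dim_col (1\<^sub>m n :: real mat)"
    then have ij: "i < n" "j < n" by auto
    have "(transpose_mat U * U) $$ (i, j) = col U i \<bullet> col U j" using U ij by simp
    also have "\<dots> = r i * r j * (ws ! i \<bullet> ws ! j)"
      using carrier_vecD[OF wi[OF ij(1)]] carrier_vecD[OF wi[OF ij(2)]] ij
      by (simp add: col scalar_prod_def sum_distrib_left mult_ac)
    also have "\<dots> = (1\<^sub>m n) $$ (i, j)"
      using orth[OF ij] pos[OF ij(1)] ij by (cases "i = j") (auto simp: r_def)
    finally show "(transpose_mat U * U) $$ (i, j) = (1\<^sub>m n) $$ (i, j)" .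
  qed (use U in auto)
  moreover have "col U 0 = r 0 \<cdot>\<^sub>v v"
    using col[OF n] hd ws(3) n by (metis hd_conv_nth length_0_conv less_numeral_extra(3))
  ultimately show ?thesis using U by blast
qed

text \<open>
  Deflation: in an orthonormal basis that starts with an eigenvector, the first column of the
  transformed matrix vanishes below the diagonal, and by symmetry so does the first row to the
  right of it.
\<close>

lemma symmetric_mat_orthonormal_diagonalization:
  fixes A :: "real mat"
  assumes "A \<in> carrier_mat n n" "transpose_mat A = A"
  shows "\<exists>U d. U \<in> carrier_mat n n \<and> transpose_mat U * U = 1\<^sub>m n
           \<and> transpose_mat U * A * U = mat n n (\<lambda>(i, j). if i = j then d i else 0)"
  using assms
proof (induction n arbitrary: A)
  case 0
  have "transpose_mat (1\<^sub>m 0) * A * 1\<^sub>m 0 = mat 0 0 f" for f by (rule eq_matI) (use 0 in auto)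
  then show ?case by (intro exI[of _ "1\<^sub>m 0"]) auto
next
  case (Suc m)
  note A = Suc.prems(1) and sym = Suc.prems(2)
  obtain e where "eigenvalue A e" using symmetric_mat_real_eigenvalue[OF A sym] by auto
  then obtain v where v: "v \<in> carrier_vec (Suc m)" "v \<noteq> 0\<^sub>v (Suc m)" "A *\<^sub>v v = e \<cdot>\<^sub>v v"
    using A unfolding eigenvalue_def eigenvector_def by auto
  obtain W c where W: "W \<in> carrier_mat (Suc m) (Suc m)" "transpose_mat W * W = 1\<^sub>m (Suc m)" "col W 0 = c \<cdot>\<^sub>v v"
    using orthonormal_matrix_with_first_column[OF v(1,2)] by blast
  have Wt: "transpose_mat W \<in> carrier_mat (Suc m) (Suc m)" using W(1) by simp
  define B where "B = transpose_mat W * A * W"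
  have B: "B \<in> carrier_mat (Suc m) (Suc m)" using W(1) A by (simp add: B_def)
  have Bsym: "transpose_mat B = B"
    unfolding B_def using W(1) Wt A sym
    by (simp add: transpose_mult[of _ "Suc m" "Suc m" _ "Suc m"] assoc_mult_mat[of _ "Suc m" "Suc m" _ "Suc m" _ "Suc m"])
  have B0: "B $$ (i, 0) = (if i = 0 then e else 0)" if i: "i < Suc m" for i
  proof -
    have "A *\<^sub>v col W 0 = e \<cdot>\<^sub>v col W 0"
      unfolding W(3) using A v by (simp add: mult_mat_vec[of _ "Suc m" "Suc m"] smult_smult_assoc mult.commute)
    moreover have "B $$ (i, 0) = row (transpose_mat W) i \<bullet> col (A * W) 0"
      unfolding B_def using W(1) Wt A i by (simp add: assoc_mult_mat[OF Wt A W(1)])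
    moreover have "col (A * W) 0 = A *\<^sub>v col W 0" using A W(1) by (intro eq_vecI) auto
    ultimately have "B $$ (i, 0) = e * (row (transpose_mat W) i \<bullet> col W 0)"
      using W(1) i by (simp add: scalar_prod_smult_distrib[of _ "Suc m"])
    also have "row (transpose_mat W) i \<bullet> col W 0 = (transpose_mat W * W) $$ (i, 0)" using W(1) i by simp
    finally show ?thesis using W(2) i by simp
  qed
  have Bij: "B $$ (i, j) = B $$ (j, i)" if "i < Suc m" "j < Suc m" for i j
    using arg_cong[OF Bsym, of "\<lambda>M. M $$ (i, j)"] B that by simp
  define C where "C = mat m m (\<lambda>(i, j). B $$ (Suc i, Suc j))"
  have C: "C \<in> carrier_mat m m" by (simp add: C_def)
  have Csym: "transpose_mat C = C" by (rule eq_matI) (auto simp: C_def Bij)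
  have Bblock: "B = four_block_mat (mat 1 1 (\<lambda>_. e)) (0\<^sub>m 1 m) (0\<^sub>m m 1) C"
    using B B0 Bij[of 0] by (intro eq_matI) (auto simp: C_def four_block_mat_def Let_def)
  obtain V d where V: "V \<in> carrier_mat m m" "transpose_mat V * V = 1\<^sub>m m"
    "transpose_mat V * C * V = mat m m (\<lambda>(i, j). if i = j then d i else 0)"
    using Suc.IH[OF C Csym] by blast
  have Vt: "transpose_mat V \<in> carrier_mat m m" using V(1) by simp
  define X where "X = four_block_mat (1\<^sub>m 1) (0\<^sub>m 1 m) (0\<^sub>m m 1) V"
  have X: "X \<in> carrier_mat (Suc m) (Suc m)" 
    using four_block_carrier_mat[of "1\<^sub>m 1" 1 1 V m m] V(1) by (simp add: X_def)
  have Xt: "transpose_mat X = four_block_mat (1\<^sub>m 1) (0\<^sub>m 1 m) (0\<^sub>m m 1) (transpose_mat V)"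
    unfolding X_def using V(1) by (subst transpose_four_block_mat[of _ 1 1 _ m _ m]) auto
  have Xt': "transpose_mat X \<in> carrier_mat (Suc m) (Suc m)" using X by simp
  have XX: "transpose_mat X * X = 1\<^sub>m (Suc m)"
    unfolding Xt unfolding X_def using V Vt
    by (subst mult_four_block_mat[of _ 1 1 _ m _ m _ _ 1 _ m]) auto
  have XB: "transpose_mat X * B = four_block_mat (mat 1 1 (\<lambda>_. e)) (0\<^sub>m 1 m) (0\<^sub>m m 1) (transpose_mat V * C)"
    unfolding Xt Bblock using V Vt C
    by (subst mult_four_block_mat[of _ 1 1 _ m _ m _ _ 1 _ m]) auto
  have XBX: "transpose_mat X * B * X
      = four_block_mat (mat 1 1 (\<lambda>_. e)) (0\<^sub>m 1 m) (0\<^sub>m m 1) (transpose_mat V * C * V)"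
    unfolding XB unfolding X_def using V Vt C
    by (subst mult_four_block_mat[of _ 1 1 _ m _ m _ _ 1 _ m]) auto
  define U where "U = W * X"
  have "U \<in> carrier_mat (Suc m) (Suc m)" using W(1) X by (simp add: U_def)
  moreover have Ut: "transpose_mat U = transpose_mat X * transpose_mat W"
    unfolding U_def by (rule transpose_mult[OF W(1) X])
  moreover have "transpose_mat U * U = 1\<^sub>m (Suc m)"
  proof -
    have "transpose_mat U * U = transpose_mat X * (transpose_mat W * W) * X"
      unfolding Ut unfolding U_def using W(1) Wt X Xt'
      by (simp add: assoc_mult_mat[of _ "Suc m" "Suc m" _ "Suc m" _ "Suc m"])
    then show ?thesis using W(2) Xt' XX by simp
  qed
  moreover have "transpose_mat U * A * U
      = mat (Suc m) (Suc m) (\<lambda>(i, j). if i = j then case i of 0 \<Rightarrow> e | Suc i' \<Rightarrow> d i' else 0)"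
  proof -
    have "transpose_mat U * A * U = transpose_mat X * B * X"
      unfolding Ut unfolding U_def B_def using W(1) Wt X Xt' A
      by (simp add: assoc_mult_mat[of _ "Suc m" "Suc m" _ "Suc m" _ "Suc m"])
    then show ?thesis unfolding XBX V(3)
      by (intro eq_matI) (auto simp: four_block_mat_def Let_def split: nat.splits)
  qed
  ultimately show ?case by blast
qed

lemma symmetric_mat_spectral_theorem:
  fixes A :: "real mat"
  assumes A: "A \<in> carrier_mat n n" and sym: "transpose_mat A = A"
  shows "\<exists>d u. eigenvalues_mset A = image_mset d (mset_set {..<n})
    \<and> (\<forall>k<n. \<forall>l<n. (\<Sum>i<n. u k i * u l i) = (if k = l then 1 else 0))
    \<and> (\<forall>i<n. \<forall>j<n. A $$ (i, j) = (\<Sum>k<n. d k * u k i * u k j))"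
proof -
  obtain U d where U: "U \<in> carrier_mat n n" "transpose_mat U * U = 1\<^sub>m n"
    "transpose_mat U * A * U = mat n n (\<lambda>(i, j). if i = j then d i else 0)"
    using symmetric_mat_orthonormal_diagonalization[OF A sym] by blast
  define D where "D = mat n n (\<lambda>(i, j). if i = j then d i else (0 :: real))"
  have D: "D \<in> carrier_mat n n" by (simp add: D_def)
  have Ut: "transpose_mat U \<in> carrier_mat n n" using U(1) by simp
  have UUt: "U * transpose_mat U = 1\<^sub>m n" by (rule mat_mult_left_right_inverse[OF Ut U(1,2)])
  have AD: "A = U * D * transpose_mat U"
  proof -
    have "U * D * transpose_mat U = (U * transpose_mat U) * A * (U * transpose_mat U)"
      unfolding D_def U(3)[symmetric] using U(1) Ut A
      by (simp add: assoc_mult_mat[of _ n n _ n _ n])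
    then show ?thesis unfolding UUt using A by simp
  qed
  have "similar_mat_wit A D U (transpose_mat U)"
    by (rule similar_mat_witI[OF UUt U(2) AD A D U(1) Ut])
  then have "similar_mat A D" unfolding similar_mat_def by blast
  then have "char_poly A = char_poly D" by (rule char_poly_similar)
  also have "\<dots> = (\<Prod>a\<leftarrow>diag_mat D. [:- a, 1:])"
    by (rule char_poly_upper_triangular[OF D]) (auto simp: D_def upper_triangular_def)
  also have "diag_mat D = map d [0..<n]" by (simp add: diag_mat_def D_def)
  also have "(\<Prod>a\<leftarrow>map d [0..<n]. [:- a, 1:]) = (\<Prod>i<n. [:- d i, 1:])"
    using prod.distinct_set_conv_list[of "[0..<n]" "\<lambda>i. [:- d i, 1:]"]
    by (simp add: comp_def lessThan_atLeast0)
  finally have "eigenvalues_mset A = proots (\<Prod>i<n. [:- d i, 1:])" by (simp add: eigenvalues_mset_def)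
  also have "\<dots> = (\<Sum>i<n. {#d i#})" by (subst proots_prod) auto
  also have "\<dots> = image_mset d (mset_set {..<n})" by (induction n) (auto simp: lessThan_Suc)
  finally have "eigenvalues_mset A = image_mset d (mset_set {..<n})" .
  moreover have "(\<Sum>i<n. U $$ (i, k) * U $$ (i, l)) = (if k = l then 1 else 0)" if "k < n" "l < n" for k l
    using arg_cong[OF U(2), of "\<lambda>M. M $$ (k, l)"] U(1) that
    by (simp add: scalar_prod_def lessThan_atLeast0)
  moreover have "A $$ (i, j) = (\<Sum>k<n. d k * U $$ (i, k) * U $$ (j, k))" if ij: "i < n" "j < n" for i j
  proof -
    have UD: "(U * D) $$ (i, k) = d k * U $$ (i, k)" if "k < n" for k
    proof -
      have "(U * D) $$ (i, k) = (\<Sum>l = 0..<n. if l = k then d k * U $$ (i, k) else 0)"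
        using U(1) ij that by (simp add: scalar_prod_def D_def if_distrib[where f = "\<lambda>y. _ * y"] cong: if_cong)
      then show ?thesis using that by simp
    qed
    define M where "M = U * D"
    have M: "M \<in> carrier_mat n n" using U(1) D by (simp add: M_def)
    have "A $$ (i, j) = (M * transpose_mat U) $$ (i, j)" using AD by (simp add: M_def)
    also have "\<dots> = row M i \<bullet> col (transpose_mat U) j" using M U(1) ij by simp
    also have "\<dots> = (\<Sum>k = 0..<n. M $$ (i, k) * U $$ (j, k))"
      unfolding scalar_prod_def using M U(1) ij by simp
    finally have "A $$ (i, j) = (\<Sum>k = 0..<n. (U * D) $$ (i, k) * U $$ (j, k))" by (simp only: M_def)
    then show ?thesis by (simp add: UD lessThan_atLeast0)
  qed
  ultimately show ?thesis
    by (intro exI[of _ d] exI[of _ "\<lambda>k i. U $$ (i, k)"]) auto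
qed

section \<open>Square energies and gains\<close>

lemma sum_mset_filter_image_lessThan:
  fixes f :: "'b \<Rightarrow> real" and n :: nat
  shows "(\<Sum>x\<in>#{#x \<in># image_mset d (mset_set {..<n}). P x#}. f x) = (\<Sum>k<n. if P (d k) then f (d k) else 0)"
  by (induction n) (auto simp: lessThan_Suc)

lemma positive_square_energy_eq:
  fixes n :: nat
  assumes "eigenvalues_mset A = image_mset d (mset_set {..<n})"
  shows "positive_square_energy A = (\<Sum>k<n. (max (d k) 0)\<^sup>2)"
proof -
  have "positive_square_energy A = (\<Sum>k<n. if (\<lambda>x. x > 0) (d k) then (d k)\<^sup>2 else 0)"
    unfolding positive_square_energy_def assms by (rule sum_mset_filter_image_lessThan)
  also have "\<dots> = (\<Sum>k<n. (max (d k) 0)\<^sup>2)" by (intro sum.cong) auto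
  finally show ?thesis .
qed

lemma negative_square_energy_eq:
  fixes n :: nat
  assumes "eigenvalues_mset A = image_mset d (mset_set {..<n})"
  shows "negative_square_energy A = (\<Sum>k<n. (max (- d k) 0)\<^sup>2)"
proof -
  have "negative_square_energy A = (\<Sum>k<n. if (\<lambda>x. x < 0) (d k) then (d k)\<^sup>2 else 0)"
    unfolding negative_square_energy_def assms by (rule sum_mset_filter_image_lessThan)
  also have "\<dots> = (\<Sum>k<n. (max (- d k) 0)\<^sup>2)" by (intro sum.cong) auto
  finally show ?thesis .
qed

text \<open>
  This identity is the computation behind Schur's product theorem: for nonnegative \<open>a\<close> the
  right-hand side is nonnegative whenever \<open>K\<close> is positive semidefinite. With \<open>K\<close> constant it also
  evaluates Frobenius norms.
\<close>

lemma weighted_square_sum_eq: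
  fixes K :: "nat \<Rightarrow> nat \<Rightarrow> real"
  shows "(\<Sum>i<n. \<Sum>j<n. K i j * (\<Sum>k<n. a k * u k i * u k j)\<^sup>2)
       = (\<Sum>k<n. \<Sum>l<n. a k * a l * quad_form {..<n} K (\<lambda>i. u k i * u l i))"
proof -
  have "(\<Sum>i<n. \<Sum>j<n. K i j * (\<Sum>k<n. a k * u k i * u k j)\<^sup>2)
      = (\<Sum>i<n. \<Sum>j<n. \<Sum>k<n. \<Sum>l<n. a k * a l * ((u k i * u l i) * (u k j * u l j) * K i j))"
    by (simp add: power2_eq_square sum_product sum_distrib_left mult_ac)
  also have "\<dots> = (\<Sum>i<n. \<Sum>k<n. \<Sum>j<n. \<Sum>l<n. a k * a l * ((u k i * u l i) * (u k j * u l j) * K i j))"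
    by (intro sum.cong refl sum.swap)
  also have "\<dots> = (\<Sum>k<n. \<Sum>i<n. \<Sum>j<n. \<Sum>l<n. a k * a l * ((u k i * u l i) * (u k j * u l j) * K i j))"
    by (rule sum.swap)
  also have "\<dots> = (\<Sum>k<n. \<Sum>i<n. \<Sum>l<n. \<Sum>j<n. a k * a l * ((u k i * u l i) * (u k j * u l j) * K i j))"
    by (intro sum.cong refl sum.swap)
  also have "\<dots> = (\<Sum>k<n. \<Sum>l<n. \<Sum>i<n. \<Sum>j<n. a k * a l * ((u k i * u l i) * (u k j * u l j) * K i j))"
    by (intro sum.cong refl sum.swap)
  finally show ?thesis by (simp add: quad_form_def sum_distrib_left)
qed

lemma frobenius_eq_sum_squares:
  fixes u :: "nat \<Rightarrow> nat \<Rightarrow> real"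
  assumes "\<And>k l. k < n \<Longrightarrow> l < n \<Longrightarrow> (\<Sum>i<n. u k i * u l i) = (if k = l then 1 else 0)"
  shows "(\<Sum>i<n. \<Sum>j<n. (\<Sum>k<n. a k * u k i * u k j)\<^sup>2) = (\<Sum>k<n. (a k)\<^sup>2)"
proof -
  have "(\<Sum>i<n. \<Sum>j<n. (\<Sum>k<n. a k * u k i * u k j)\<^sup>2)
      = (\<Sum>k<n. \<Sum>l<n. a k * a l * (\<Sum>i<n. u k i * u l i)\<^sup>2)"
    using weighted_square_sum_eq[where K = "\<lambda>_ _. 1" and n = n and a = a and u = u]
    by (simp add: quad_form_def power2_eq_square sum_product)
  also have "\<dots> = (\<Sum>k<n. \<Sum>l<n. if k = l then (a k)\<^sup>2 else 0)"
    by (intro sum.cong refl) (auto simp: assms power2_eq_square)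
  finally show ?thesis by simp
qed

text \<open>
  The inequality holds entry by entry after adding \<open>K u v * (N u v)^2\<close> to the gain, a quantity with
  nonnegative sum. Only the absolute value of \<open>P - N\<close> on the edges enters, which makes the lemma
  applicable with the roles of the positive and the negative part exchanged.
\<close>

lemma frobenius_ge_gain:
  fixes P N K :: "'a \<Rightarrow> 'a \<Rightarrow> real"
  assumes "finite V" "correlation_on V K" and K: "\<And>u v. u \<in> V \<Longrightarrow> v \<in> V \<Longrightarrow> E u v \<Longrightarrow> K u v \<le> 0"
    and N: "0 \<le> (\<Sum>u\<in>V. \<Sum>v\<in>V. K u v * (N u v)\<^sup>2)"
    and edge: "\<And>u v. u \<in> V \<Longrightarrow> v \<in> V \<Longrightarrow> E u v \<Longrightarrow> \<bar>P u v - N u v\<bar> = 1"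
    and nonedge: "\<And>u v. u \<in> V \<Longrightarrow> v \<in> V \<Longrightarrow> \<not> E u v \<Longrightarrow> P u v = N u v"
  shows "gain E V K \<le> (\<Sum>u\<in>V. \<Sum>v\<in>V. (P u v)\<^sup>2)"
proof -
  have "(if E u v then - K u v / (1 - K u v) else 0) + K u v * (N u v)\<^sup>2 \<le> (P u v)\<^sup>2"
    if uv: "u \<in> V" "v \<in> V" for u v
  proof (cases "E u v")
    case False
    have "K u v * (N u v)\<^sup>2 \<le> 1 * (N u v)\<^sup>2"
      using correlation_abs_le_1[OF assms(1,2) uv] by (intro mult_right_mono) auto
    then show ?thesis using False nonedge[OF uv] by simp
  next
    case True
    define \<kappa> where "\<kappa> = - K u v"
    have \<kappa>: "\<kappa> \<ge> 0" using K[OF uv True] by (simp add: \<kappa>_def)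
    define p where "p = \<bar>P u v\<bar>"
    define q where "q = \<bar>N u v\<bar>"
    have q: "1 - p \<le> q" "0 \<le> p" "0 \<le> q" using edge[OF uv True] by (auto simp: p_def q_def)
    have "\<kappa> \<le> (p\<^sup>2 + \<kappa> * q\<^sup>2) * (1 + \<kappa>)"
    proof -
      have "1 \<le> (p + q)\<^sup>2" using q by (simp add: one_le_power)
      then have "\<kappa> * 1 \<le> \<kappa> * (p + q)\<^sup>2" using \<kappa> by (rule mult_left_mono)
      moreover have "(p\<^sup>2 + \<kappa> * q\<^sup>2) * (1 + \<kappa>) = \<kappa> * (p + q)\<^sup>2 + (p - \<kappa> * q)\<^sup>2"
        by (simp add: power2_eq_square algebra_simps)
      moreover have "0 \<le> (p - \<kappa> * q)\<^sup>2" by simp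
      ultimately show ?thesis by linarith
    qed
    then have "\<kappa> / (1 + \<kappa>) \<le> p\<^sup>2 + \<kappa> * q\<^sup>2" using \<kappa> by (simp add: pos_divide_le_eq)
    then show ?thesis using True by (simp add: \<kappa>_def p_def q_def)
  qed
  then have "(\<Sum>u\<in>V. \<Sum>v\<in>V. (if E u v then - K u v / (1 - K u v) else 0) + K u v * (N u v)\<^sup>2)
      \<le> (\<Sum>u\<in>V. \<Sum>v\<in>V. (P u v)\<^sup>2)" by (intro sum_mono)
  then show ?thesis using N unfolding gain_def by (simp add: sum.distrib)
qed

lemma certified_square_energy_bounds:
  fixes E :: "nat \<Rightarrow> nat \<Rightarrow> bool"
  assumes cert: "certifies E {..<n} r"
    and sym: "\<And>i j. i < n \<Longrightarrow> j < n \<Longrightarrow> E i j \<Longrightarrow> E j i"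
  defines "A \<equiv> mat n n (\<lambda>(i, j). if E i j then 1 else 0)"
  shows "r \<le> positive_square_energy A" and "r \<le> negative_square_energy A"
proof -
  have A: "A \<in> carrier_mat n n" by (simp add: A_def)
  have "transpose_mat A = A" by (rule eq_matI) (auto simp: A_def dest: sym)
  from symmetric_mat_spectral_theorem[OF A this] obtain d u where
    d: "eigenvalues_mset A = image_mset d (mset_set {..<n})"
    and orth: "\<And>k l. k < n \<Longrightarrow> l < n \<Longrightarrow> (\<Sum>i<n. u k i * u l i) = (if k = l then 1 else 0)"
    and Aij: "\<And>i j. i < n \<Longrightarrow> j < n \<Longrightarrow> A $$ (i, j) = (\<Sum>k<n. d k * u k i * u k j)"
    by blast
  obtain K where K: "correlation_on {..<n} K"
    "\<And>i j. i \<in> {..<n} \<Longrightarrow> j \<in> {..<n} \<Longrightarrow> E i j \<Longrightarrow> K i j \<le> 0" "r \<le> gain E {..<n} K"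
    using cert unfolding certifies_def by blast
  define S where "S a i j = (\<Sum>k<n. a k * u k i * u k j)" for a :: "nat \<Rightarrow> real" and i j
  let ?p = "\<lambda>k. max (d k) 0" and ?m = "\<lambda>k. max (- d k) 0"
  have schur: "0 \<le> (\<Sum>i<n. \<Sum>j<n. K i j * (S a i j)\<^sup>2)" if "\<And>k. 0 \<le> a k" for a
    unfolding S_def weighted_square_sum_eq
    using that correlation_onD(3)[OF K(1)] by (intro sum_nonneg mult_nonneg_nonneg) auto
  have diff: "S ?p i j - S ?m i j = (if E i j then 1 else 0)" if "i < n" "j < n" for i j
  proof -
    have "S ?p i j - S ?m i j = (\<Sum>k<n. d k * u k i * u k j)"
      unfolding S_def sum_subtractf[symmetric] by (intro sum.cong refl) (auto simp: max_def algebra_simps)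
    then show ?thesis using Aij[OF that] that by (simp add: A_def)
  qed
  have "gain E {..<n} K \<le> (\<Sum>i<n. \<Sum>j<n. (S ?p i j)\<^sup>2)"
  proof (rule frobenius_ge_gain[OF _ K(1,2), where N = "S ?m"])
    show "0 \<le> (\<Sum>i<n. \<Sum>j<n. K i j * (S ?m i j)\<^sup>2)" by (rule schur) simp
  qed (use diff in fastforce)+
  also have "\<dots> = positive_square_energy A"
    unfolding S_def positive_square_energy_eq[OF d] by (rule frobenius_eq_sum_squares) (rule orth)
  finally show "r \<le> positive_square_energy A" using K(3) by simp
  have "gain E {..<n} K \<le> (\<Sum>i<n. \<Sum>j<n. (S ?m i j)\<^sup>2)"
  proof (rule frobenius_ge_gain[OF _ K(1,2), where N = "S ?p"])
    show "0 \<le> (\<Sum>i<n. \<Sum>j<n. K i j * (S ?p i j)\<^sup>2)" by (rule schur) simp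
  qed (use diff in fastforce)+
  also have "\<dots> = negative_square_energy A"
    unfolding S_def negative_square_energy_eq[OF d] by (rule frobenius_eq_sum_squares) (rule orth)
  finally show "r \<le> negative_square_energy A" using K(3) by simp
qed

theorem corollary4p1:
  fixes G :: "'a pair_pre_digraph" and vs :: "'a list" and n :: nat
  assumes "pair_graph G"
    and "n = card (pverts G)"
    and "distinct vs" and "set vs = pverts G"
  shows "min (positive_square_energy (adjacency_matrix vs G))
             (negative_square_energy (adjacency_matrix vs G))
         \<ge> real n - real (num_components G)"
proof -
  interpret pair_graph G by fact
  let ?E = "\<lambda>i j. (vs ! i, vs ! j) \<in> parcs G"
  have "bij_betw ((!) vs) {..<length vs} (pverts G)"
    using bij_betw_nth[OF assms(3) refl] assms(4) by simp
  then have "certifies ?E {..<length vs} (real n - real (num_components G))"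
    using certifies_reindex certifies_verts assms(2) by fastforce
  moreover have "?E j i" if "?E i j" for i j using arcs_symmetric that by blast
  ultimately show ?thesis
    unfolding adjacency_matrix_def using certified_square_energy_bounds[of ?E] by simp
qed

end
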